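(* Let $F:\mathbb{R}^m\to\mathbb{R}^m$ be a $C^1$ globally integrable vector field with induced flow $\Phi=\{\Phi_t\}$, which is gradient-like with a $C^1$ strict Lyapounov function $V:\mathbb{R}^m\to\mathbb{R}$. Let $X=(X(t))_{t\ge0}$ be an $\mathbb{R}^m$-valued continuous stochastic process which is almost surely bounded and such that, almost surely, $e(X)\le e$ for some constant $e<0$. Let $C\subset\mathsf{Eq}(F)$ be a compact connected set of equilibria. Assume that: (i) $V$ satisfies a Lojasiewicz inequality and $(F,V)$ satisfies an angle condition at every point $p\in C$; (ii) $]e,0[\;\cap\;\mathcal{R}(C)\neq\emptyset$; (iii) every point $p\in C$ is repulsive for $X$. Then $\mathbf{P}(\mathcal{L}(X)\subset C)=0$.
   Context: $\mathsf{Eq}(F)=\{x\in\mathbb{R}^m:F(x)=0\}$. "Globally integrable" means that the flow $\Phi_t(x)$ is defined for all $t\in\mathbb{R}$ and $x\in\mathbb{R}^m$. A strict Lyapounov function for $\Phi$ (or $F$) is a continuous map $V:\mathbb{R}^m\to\mathbb{R}$ with $V(\Phi_t(x))<V(x)$ for all $x\in\mathbb{R}^m\setminus\mathsf{Eq}(F)$ and $t>0$; $F$ is gradient-like if such a $V$ exists. For a bounded continuous $X:\mathbb{R}^+\to\mathbb{R}^m$, the limit set is $\mathcal{L}(X)=\bigcap_{t\ge0}\overline{\{X(t+s):s\ge0\}}$. The error rate of $X$ is $$e(X)=\limsup_{t\to\infty}\frac1t\log\Bigl(\sup_{0\le h\le T}\|X(t+h)-\Phi_h(X(t))\|\Bigr),$$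 which does not depend on the choice of $T>0$ when $X$ is a bounded asymptotic pseudotrajectory, i.e. when $\lim_{t\to\infty}\sup_{0\le h\le T}\|X(t+h)-\Phi_h(X(t))\|=0$ for all $T>0$; for random $X$ these are defined pathwise. $V$ satisfies a Lojasiewicz inequality at $p$ if there exist a neighborhood $U$ of $p$ and constants $0<\theta\le1/2$, $c_0\ge0$ such that $|V(x)-V(p)|^{1-\theta}\le c_0\|\nabla V(x)\|$ for all $x\in U$. $(F,V)$ satisfies an angle condition at $p$ if there exist a neighborhood $U$ of $p$ and $c_1>0$ such that $|\langle\nabla V(x),F(x)\rangle|\ge c_1\|\nabla V(x)\|\,\|F(x)\|$ for all $x\in U$. The Sacker–Sell resolvent $\mathcal{R}(C)$ is the set of $\lambda\in\mathbb{R}$ such that for all $x\in C$ and $v\in\mathbb{R}^m\setminus\{0\}$, $\sup_{t\in\mathbb{R}}\|e^{-\lambda t}D\Phi_t(x)v\|=\infty$. For an open set $U\subset\mathbb{R}^m$ and $s\ge0$ let $T_s^U=\inf\{t\ge s: X(t)\in\mathbb{R}^m\setminus U\}$. A point $p\in\mathbb{R}^m$ is repulsive for $X$ if there exists an open neighborhood $U$ of $p$ such that $\mathbf{P}(T_n^U<\infty)=1$ for all $n\in\mathbb{N}$. $]a,b[$ denotes the open interval. *)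

theory Defs
  imports "HOL-Probability.Probability"
begin

definition C1_map :: "('a::euclidean_space \<Rightarrow> 'b::real_normed_vector) \<Rightarrow> bool" where
  "C1_map f \<longleftrightarrow> (\<exists>f' :: 'a \<Rightarrow> 'a \<Rightarrow>\<^sub>L 'b.
     (\<forall>x. (f has_derivative blinfun_apply (f' x)) (at x)) \<and> continuous_on UNIV f')"

definition Eq :: "('a::euclidean_space \<Rightarrow> 'a) \<Rightarrow> 'a set" where
  "Eq F = {x. F x = 0}"

(* For F of class C^1 the flow is unique, so the existence of such a Phi says
   exactly that F is globally integrable, and Phi is then the induced flow. *)
definition global_flow :: "('a::euclidean_space \<Rightarrow> 'a) \<Rightarrow> (real \<Rightarrow> 'a \<Rightarrow> 'a) \<Rightarrow> bool" where
  "global_flow F \<Phi> \<longleftrightarrow> (\<forall>x. \<Phi> 0 x = x \<and>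
     (\<forall>t. ((\<lambda>s. \<Phi> s x) has_vector_derivative F (\<Phi> t x)) (at t)))"

definition strict_lyapunov ::
  "('a::euclidean_space \<Rightarrow> 'a) \<Rightarrow> (real \<Rightarrow> 'a \<Rightarrow> 'a) \<Rightarrow> ('a \<Rightarrow> real) \<Rightarrow> bool" where
  "strict_lyapunov F \<Phi> V \<longleftrightarrow> continuous_on UNIV V \<and>
     (\<forall>x \<in> UNIV - Eq F. \<forall>t>0. V (\<Phi> t x) < V x)"

definition limit_set :: "(real \<Rightarrow> 'a::euclidean_space) \<Rightarrow> 'a set" where
  "limit_set Y = (\<Inter>t\<in>{0..}. closure {Y (t + s) |s. 0 \<le> s})"

(* log with log 0 = -\<infinity>; the library convention ln 0 = 0 would be wrong in
   error_rate when the pseudotrajectory error vanishes. *)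
definition ext_log :: "real \<Rightarrow> ereal" where
  "ext_log r = (if r = 0 then -\<infinity> else ereal (ln r))"

(* T is the window length; for bounded asymptotic pseudotrajectories the value
   is the same for every T > 0. *)
definition error_rate ::
  "real \<Rightarrow> (real \<Rightarrow> 'a::euclidean_space \<Rightarrow> 'a) \<Rightarrow> (real \<Rightarrow> 'a) \<Rightarrow> ereal" where
  "error_rate T \<Phi> Y = Limsup at_top
     (\<lambda>t. ereal (1 / t) * ext_log (SUP h\<in>{0..T}. norm (Y (t + h) - \<Phi> h (Y t))))"

definition gradient :: "('a::euclidean_space \<Rightarrow> real) \<Rightarrow> 'a \<Rightarrow> 'a" where
  "gradient V x = (THE g. GDERIV V x :> g)"

definition lojasiewicz_at :: "('a::euclidean_space \<Rightarrow> real) \<Rightarrow> 'a \<Rightarrow> bool" where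
  "lojasiewicz_at V p \<longleftrightarrow> (\<exists>U \<theta> c\<^sub>0. open U \<and> p \<in> U \<and> 0 < \<theta> \<and> \<theta> \<le> 1 / 2 \<and> 0 \<le> c\<^sub>0 \<and>
     (\<forall>x\<in>U. \<bar>V x - V p\<bar> powr (1 - \<theta>) \<le> c\<^sub>0 * norm (gradient V x)))"

definition angle_condition_at ::
  "('a::euclidean_space \<Rightarrow> 'a) \<Rightarrow> ('a \<Rightarrow> real) \<Rightarrow> 'a \<Rightarrow> bool" where
  "angle_condition_at F V p \<longleftrightarrow> (\<exists>U c\<^sub>1. open U \<and> p \<in> U \<and> 0 < c\<^sub>1 \<and>
     (\<forall>x\<in>U. c\<^sub>1 * norm (gradient V x) * norm (F x) \<le> \<bar>gradient V x \<bullet> F x\<bar>))"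

(* The supremum is taken in the extended reals, so that it equals \<infinity> iff the
   set of values is unbounded. *)
definition sacker_sell_resolvent ::
  "(real \<Rightarrow> 'a::euclidean_space \<Rightarrow> 'a) \<Rightarrow> 'a set \<Rightarrow> real set" where
  "sacker_sell_resolvent \<Phi> C = {l. \<forall>x\<in>C. \<forall>v. v \<noteq> 0 \<longrightarrow>
     (SUP t. ereal (norm (exp (- l * t) *\<^sub>R frechet_derivative (\<Phi> t) (at x) v))) = \<infinity>}"

definition exit_time ::
  "(real \<Rightarrow> 'w \<Rightarrow> 'a::euclidean_space) \<Rightarrow> 'a set \<Rightarrow> real \<Rightarrow> 'w \<Rightarrow> ereal" where
  "exit_time X U s \<omega> = Inf {ereal t |t. s \<le> t \<and> X t \<omega> \<in> UNIV - U}"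

(* Probability 1 here entails measurability, since measure is 0 on
   non-measurable sets. *)
definition repulsive ::
  "'w measure \<Rightarrow> (real \<Rightarrow> 'w \<Rightarrow> 'a::euclidean_space) \<Rightarrow> 'a \<Rightarrow> bool" where
  "repulsive M X p \<longleftrightarrow> (\<exists>U. open U \<and> p \<in> U \<and>
     (\<forall>n::nat. measure M {\<omega> \<in> space M. exit_time X U (real n) \<omega> < \<infinity>} = 1))"

(* The process is indexed by t \<ge> 0; values at negative times are unconstrained. *)
definition continuous_process ::
  "'w measure \<Rightarrow> (real \<Rightarrow> 'w \<Rightarrow> 'a::euclidean_space) \<Rightarrow> bool" where
  "continuous_process M X \<longleftrightarrow> (\<forall>t\<ge>0. X t \<in> borel_measurable M) \<and>
     (\<forall>\<omega>\<in>space M. continuous_on {0..} (\<lambda>t. X t \<omega>))"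

end

theory Submission
  imports Defs
begin

text \<open>Every path of \<open>X\<close> whose limit set \<open>L\<close> lies in \<open>C\<close> converges to a point of \<open>C\<close>, whereas
  repulsiveness and compactness of \<open>C\<close> force almost every path to leave, at arbitrarily late times,
  each member of a finite open cover of \<open>C\<close>.
  For the convergence, sample the path at \<open>x n = X (t0 + n T)\<close>: the pseudotrajectory error on the
  \<open>n\<close>-th window is at most \<open>r ^ n\<close> for some \<open>r < 1\<close>. Since \<open>V\<close> decreases along the flow, it converges
  along the path to some \<open>v\<close>, and \<open>V = v\<close> on \<open>L\<close>. With \<open>g a = sgn a * \<bar>a\<bar> powr \<theta>\<close>, the Lojasiewicz
  inequality and the angle condition bound the displacement of a flow line near \<open>L\<close> by a multiple of
  the decrease of \<open>g (V - v)\<close>, on both sides of the level \<open>v\<close>. As \<open>g\<close> is \<open>\<theta>\<close>-Hoelder, replacing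
  the end point of the flow line by \<open>x (n + 1)\<close> costs only \<open>O(r powr (\<theta> n))\<close>, so the displacements
  of \<open>x\<close> are bounded by a telescoping series plus a geometric one.\<close>

section \<open>Signed powers\<close>

text \<open>Dividing by \<open>(a + b) powr \<theta>\<close> reduces this to
  \<open>y \<le> y powr \<theta>\<close> for the two fractions \<open>y\<close> in [0,1], which sum
  to 1.\<close>

lemma powr_add_le:
  fixes a b \<theta> :: real
  assumes "0 \<le> a" "0 \<le> b" "0 \<le> \<theta>" "\<theta> \<le> 1"
  shows "(a + b) powr \<theta> \<le> a powr \<theta> + b powr \<theta>"
proof (cases "a + b = 0")
  case False
  then have s: "a + b > 0" using assms by simp
  have le: "x / (a + b) \<le> (x / (a + b)) powr \<theta>" if "0 \<le> x" "x \<le> a + b" for x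
  proof (cases "x = 0")
    case False
    then show ?thesis
      using powr_mono'[of \<theta> 1 "x / (a + b)"] that s assms by simp
  qed simp
  have "1 = a / (a + b) + b / (a + b)"
    using s by (simp add: add_divide_distrib[symmetric])
  also have "\<dots> \<le> (a powr \<theta> + b powr \<theta>) / (a + b) powr \<theta>"
    using le[of a] le[of b] assms by (simp add: powr_divide add_divide_distrib)
  finally show ?thesis
    using s by (simp add: pos_le_divide_eq)
qed (use assms in auto)

text \<open>The odd extension of the power is the desingularising function. It must accept negative
  arguments because the perturbed path may bring \<open>V\<close> below its limit level.\<close>

definition signed_powr :: "real \<Rightarrow> real \<Rightarrow> real" where
  "signed_powr \<theta> a = sgn a * \<bar>a\<bar> powr \<theta>"

lemma signed_powr_mono:
  assumes "0 \<le> \<theta>" "a \<le> b"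
  shows "signed_powr \<theta> a \<le> signed_powr \<theta> b"
proof -
  consider "0 < a" | "a \<le> 0" "0 \<le> b" | "b < 0" using assms by linarith
  then show ?thesis
  proof cases
    case 1 then show ?thesis using assms by (simp add: signed_powr_def powr_mono2)
  next
    case 2
    then have "signed_powr \<theta> a \<le> 0" "0 \<le> signed_powr \<theta> b"
      by (auto simp: signed_powr_def sgn_if)
    then show ?thesis by simp
  next
    case 3 then show ?thesis using assms powr_mono2[of \<theta> "-b" "-a"] by (simp add: signed_powr_def)
  qed
qed

text \<open>For arguments of equal sign, subadditivity of the power gives the bound. For opposite
  signs each power is separately at most \<open>\<bar>a - b\<bar> powr \<theta>\<close>, whence the
  factor 2.\<close>

lemma signed_powr_holder:
  assumes "0 \<le> \<theta>" "\<theta> \<le> 1"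
  shows "\<bar>signed_powr \<theta> a - signed_powr \<theta> b\<bar> \<le> 2 * \<bar>a - b\<bar> powr \<theta>"
proof -
  have "\<bar>signed_powr \<theta> a - signed_powr \<theta> b\<bar> \<le> 2 * (a - b) powr \<theta>" if "b < a" for a b
  proof -
    consider "0 < b" | "b \<le> 0" "0 \<le> a" | "a < 0" using that by linarith
    then show ?thesis
    proof cases
      case 1
      then show ?thesis
        using powr_add_le[of b "a - b" \<theta>] powr_mono2[of \<theta> b a] assms that powr_ge_zero[of "a - b" \<theta>]
        by (simp add: signed_powr_def)
    next
      case 2
      then have "a powr \<theta> \<le> (a - b) powr \<theta>" "(-b) powr \<theta> \<le> (a - b) powr \<theta>"
        using assms by (auto intro!: powr_mono2)
      moreover have "\<bar>signed_powr \<theta> a - signed_powr \<theta> b\<bar> \<le> a powr \<theta> + (-b) powr \<theta>"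
        using 2 by (auto simp: signed_powr_def sgn_if)
      ultimately show ?thesis by linarith
    next
      case 3
      then show ?thesis
        using powr_add_le[of "-a" "a - b" \<theta>] powr_mono2[of \<theta> "-a" "-b"] assms that powr_ge_zero[of "a - b" \<theta>]
        by (simp add: signed_powr_def)
    qed
  qed
  from this[of b a] this[of a b] show ?thesis
    by (cases a b rule: linorder_cases) (auto simp: abs_minus_commute)
qed

lemma has_real_derivative_signed_powr:
  assumes "a \<noteq> 0"
  shows "(signed_powr \<theta> has_real_derivative \<theta> * \<bar>a\<bar> powr (\<theta> - 1)) (at a)"
proof (cases "a > 0")
  case True
  have "((\<lambda>x. x powr \<theta>) has_real_derivative \<theta> * \<bar>a\<bar> powr (\<theta> - 1)) (at a)"
    using True by (auto intro!: derivative_eq_intros)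
  moreover have "\<forall>\<^sub>F x in nhds a. signed_powr \<theta> x = x powr \<theta>"
    using eventually_nhds_in_open[of "{0<..}" a] True
    by (auto simp: signed_powr_def elim!: eventually_mono)
  ultimately show ?thesis
    by (subst DERIV_cong_ev[OF refl _ refl])
next
  case False
  with assms have a: "a < 0" by simp
  have "((\<lambda>x. - ((-x) powr \<theta>)) has_real_derivative \<theta> * \<bar>a\<bar> powr (\<theta> - 1)) (at a)"
    using a by (auto intro!: derivative_eq_intros)
  moreover have "\<forall>\<^sub>F x in nhds a. signed_powr \<theta> x = - ((-x) powr \<theta>)"
    using eventually_nhds_in_open[of "{..<0}" a] a
    by (auto simp: signed_powr_def elim!: eventually_mono)
  ultimately show ?thesis
    by (subst DERIV_cong_ev[OF refl _ refl])
qed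

text \<open>The Hoelder estimate covers all points at once, including 0, where the derivative
  formula does not apply.\<close>

lemma continuous_on_signed_powr:
  assumes "0 < \<theta>" "\<theta> \<le> 1"
  shows "continuous_on A (signed_powr \<theta>)"
proof -
  have "(signed_powr \<theta> \<longlongrightarrow> signed_powr \<theta> a) (at a)" for a
  proof (rule LIM_zero_cancel, rule Lim_null_comparison)
    show "\<forall>\<^sub>F x in at a. norm (signed_powr \<theta> x - signed_powr \<theta> a) \<le> 2 * \<bar>x - a\<bar> powr \<theta>"
      using signed_powr_holder[of \<theta>] assms by (auto intro!: always_eventually)
    have "((\<lambda>x. 2 * \<bar>x - a\<bar> powr \<theta>) \<longlongrightarrow> 2 * \<bar>a - a\<bar> powr \<theta>) (at a)"
      using assms by (intro tendsto_intros tendsto_powr') auto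
    then show "((\<lambda>x. 2 * \<bar>x - a\<bar> powr \<theta>) \<longlongrightarrow> 0) (at a)" by simp
  qed
  then show ?thesis
    by (simp add: continuous_at_imp_continuous_on isCont_def)
qed

section \<open>Flows of C1 vector fields\<close>

text \<open>The continuous derivative is bounded on the compact ball, and convexity of the ball
  permits the mean value inequality.\<close>

lemma C1_map_lipschitz_on_cball:
  fixes f :: "'a::euclidean_space \<Rightarrow> 'b::real_normed_vector"
  assumes "C1_map f"
  obtains L where "0 \<le> L" "\<And>x y. norm x \<le> R \<Longrightarrow> norm y \<le> R \<Longrightarrow> norm (f x - f y) \<le> L * norm (x - y)"
proof -
  from assms obtain f' :: "'a \<Rightarrow> 'a \<Rightarrow>\<^sub>L 'b"
    where f': "\<And>x. (f has_derivative blinfun_apply (f' x)) (at x)" "continuous_on UNIV f'"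
    unfolding C1_map_def by blast
  have "compact (f' ` cball 0 R)"
    using f'(2) by (intro compact_continuous_image) (auto intro: continuous_on_subset)
  then obtain L where L: "\<And>x. x \<in> cball 0 R \<Longrightarrow> norm (f' x) \<le> L"
    by (metis bounded_iff compact_imp_bounded imageI)
  have "norm (f x - f y) \<le> \<bar>L\<bar> * norm (x - y)" if "norm x \<le> R" "norm y \<le> R" for x y
  proof (rule differentiable_bound[of "cball 0 R"])
    show "(f has_derivative blinfun_apply (f' z)) (at z within cball 0 R)" for z
      using f'(1) has_derivative_at_withinI by blast
    show "onorm (blinfun_apply (f' z)) \<le> \<bar>L\<bar>" if "z \<in> cball 0 R" for z
      using L[OF that] by (simp add: norm_blinfun.rep_eq)
  qed (use that in auto)
  then show thesis by (intro that[of "\<bar>L\<bar>"]) auto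
qed

text \<open>A Gronwall argument: with \<open>L\<close> a Lipschitz constant of \<open>F\<close> on a
  ball containing both arcs over \<open>{a..b}\<close>, the squared distance weighted by
  \<open>exp (- 2 * L * t)\<close> does not increase, and it starts at 0.\<close>

lemma ode_unique_forward:
  fixes F :: "'a::euclidean_space \<Rightarrow> 'a"
  assumes "C1_map F"
    and u: "\<And>t. (u has_vector_derivative F (u t)) (at t)"
    and v: "\<And>t. (v has_vector_derivative F (v t)) (at t)"
    and "u a = v a" "a \<le> b"
  shows "u b = v b"
proof -
  have cont: "continuous_on A u" "continuous_on A v" for A
    using u v by (meson continuous_at_imp_continuous_on has_vector_derivative_continuous)+
  have "bounded (u ` {a..b} \<union> v ` {a..b})"
    using cont by (simp add: compact_imp_bounded compact_continuous_image)
  then obtain R where R: "\<And>t. t \<in> {a..b} \<Longrightarrow> norm (u t) \<le> R \<and> norm (v t) \<le> R"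
    unfolding bounded_iff by blast
  obtain L where L: "\<And>x y. norm x \<le> R \<Longrightarrow> norm y \<le> R \<Longrightarrow> norm (F x - F y) \<le> L * norm (x - y)"
    using C1_map_lipschitz_on_cball[OF \<open>C1_map F\<close>] by metis
  define q where "q t = exp (- 2 * L * t) * ((u t - v t) \<bullet> (u t - v t))" for t
  define q' where "q' t = exp (- 2 * L * t) * (2 * ((u t - v t) \<bullet> (F (u t) - F (v t)))
      - 2 * L * ((u t - v t) \<bullet> (u t - v t)))" for t
  have q': "(q has_real_derivative q' t) (at t)" for t
  proof -
    have d: "((\<lambda>t. u t - v t) has_derivative (\<lambda>h. h *\<^sub>R (F (u t) - F (v t)))) (at t)"
      using has_vector_derivative_diff[OF u v] by (simp add: has_vector_derivative_def)
    have "((\<lambda>t. (u t - v t) \<bullet> (u t - v t)) has_real_derivative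
        2 * ((u t - v t) \<bullet> (F (u t) - F (v t)))) (at t)"
      unfolding has_field_derivative_def
      by (rule has_derivative_eq_rhs[OF has_derivative_inner[OF d d]]) (auto simp: inner_commute)
    moreover have "((\<lambda>t. exp (- 2 * L * t)) has_real_derivative - 2 * L * exp (- 2 * L * t)) (at t)"
      by (auto intro!: derivative_eq_intros)
    ultimately show ?thesis
      unfolding q_def q'_def by (auto dest: DERIV_mult simp: algebra_simps elim!: DERIV_cong)
  qed
  have "q' t \<le> 0" if "t \<in> {a..b}" for t
  proof -
    have "(u t - v t) \<bullet> (F (u t) - F (v t)) \<le> norm (u t - v t) * norm (F (u t) - F (v t))"
      by (rule norm_cauchy_schwarz)
    also have "\<dots> \<le> norm (u t - v t) * (L * norm (u t - v t))"
      using L R[OF that] by (simp add: mult_left_mono)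
    also have "\<dots> = L * ((u t - v t) \<bullet> (u t - v t))"
      by (simp add: dot_square_norm power2_eq_square)
    finally show ?thesis
      unfolding q'_def by (simp add: mult_le_0_iff)
  qed
  then have "q b \<le> q a"
    using q' by (intro DERIV_nonpos_imp_nonincreasing[OF \<open>a \<le> b\<close>]) force
  then have "(u b - v b) \<bullet> (u b - v b) \<le> 0"
    using \<open>u a = v a\<close> by (simp add: q_def mult_le_0_iff)
  then show ?thesis
    by (metis inner_eq_zero_iff inner_ge_zero nle_le right_minus_eq)
qed

text \<open>Backward uniqueness is forward uniqueness for the time-reversed curves, which solve the
  equation of \<open>- F\<close>.\<close>

lemma ode_unique:
  fixes F :: "'a::euclidean_space \<Rightarrow> 'a"
  assumes "C1_map F"
    and u: "\<And>t. (u has_vector_derivative F (u t)) (at t)"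
    and v: "\<And>t. (v has_vector_derivative F (v t)) (at t)"
    and "u a = v a"
  shows "u b = v b"
proof (cases "a \<le> b")
  case True
  then show ?thesis using ode_unique_forward assms by blast
next
  case False
  have rev: "((\<lambda>t. w (- t)) has_vector_derivative - F (w (- t))) (at t)"
    if "\<And>t. (w has_vector_derivative F (w t)) (at t)" for w :: "real \<Rightarrow> 'a" and t
  proof -
    have "(uminus has_vector_derivative - 1) (at t)"
      unfolding has_real_derivative_iff_has_vector_derivative[symmetric]
      by (auto intro!: derivative_eq_intros)
    from vector_diff_chain_at[OF this that[of "- t"]] show ?thesis by (simp add: o_def)
  qed
  have "C1_map (\<lambda>x. - F x)"
  proof -
    from \<open>C1_map F\<close> obtain F' where "\<And>x. (F has_derivative blinfun_apply (F' x)) (at x)"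
      "continuous_on UNIV F'"
      unfolding C1_map_def by blast
    then show ?thesis
      unfolding C1_map_def
      by (intro exI[of _ "\<lambda>x. - F' x"])
        (auto intro!: continuous_intros derivative_eq_intros simp: uminus_blinfun.rep_eq)
  qed
  from ode_unique_forward[OF this rev[OF u] rev[OF v], of "-a" "-b"] False \<open>u a = v a\<close>
  show ?thesis by simp
qed

lemma global_flow_has_vector_derivative:
  "global_flow F \<Phi> \<Longrightarrow> ((\<lambda>s. \<Phi> s x) has_vector_derivative F (\<Phi> t x)) (at t)"
  unfolding global_flow_def by blast

lemma global_flow_0: "global_flow F \<Phi> \<Longrightarrow> \<Phi> 0 x = x"
  unfolding global_flow_def by blast

lemma continuous_on_global_flow:
  "global_flow F \<Phi> \<Longrightarrow> continuous_on A (\<lambda>s. \<Phi> s x)"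
  by (intro continuous_at_imp_continuous_on ballI)
    (rule has_vector_derivative_continuous[OF global_flow_has_vector_derivative])

lemma global_flow_add:
  assumes "C1_map F" "global_flow F \<Phi>"
  shows "\<Phi> (s + t) x = \<Phi> t (\<Phi> s x)"
proof (rule ode_unique[OF assms(1), of "\<lambda>t. \<Phi> (s + t) x" "\<lambda>t. \<Phi> t (\<Phi> s x)" 0])
  show "((\<lambda>t. \<Phi> (s + t) x) has_vector_derivative F (\<Phi> (s + t) x)) (at t)" for t
  proof -
    have "((\<lambda>t. s + t) has_vector_derivative 1) (at t)"
      unfolding has_real_derivative_iff_has_vector_derivative[symmetric]
      by (auto intro!: derivative_eq_intros)
    from vector_diff_chain_at[OF this global_flow_has_vector_derivative[OF assms(2)]]
    show ?thesis by (simp add: o_def)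
  qed
qed (use assms in \<open>auto simp: global_flow_0 global_flow_has_vector_derivative\<close>)

text \<open>The constant curve solves the same equation, and uniqueness holds in both time
  directions. Hence an orbit that contains an equilibrium is a single point.\<close>

lemma global_flow_stationary:
  assumes "C1_map F" "global_flow F \<Phi>" "F (\<Phi> s x) = 0"
  shows "\<Phi> t x = \<Phi> s x"
  by (rule ode_unique[OF assms(1), of "\<lambda>t. \<Phi> t x" "\<lambda>t. \<Phi> s x" s])
    (use assms in \<open>auto simp: global_flow_has_vector_derivative\<close>)

section \<open>Lyapunov functions along the flow\<close>

text \<open>The vector representing the derivative is built from its values on the basis. Uniqueness
  of derivatives then shows that the definite description in \<open>gradient\<close> denotes
  it.\<close>

lemma C1_map_has_derivative_gradient:
  fixes V :: "'a::euclidean_space \<Rightarrow> real"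
  assumes "C1_map V"
  shows "(V has_derivative (\<lambda>h. gradient V x \<bullet> h)) (at x)"
proof -
  obtain D where D: "(V has_derivative D) (at x)"
    using assms unfolding C1_map_def by blast
  define g where "g = (\<Sum>b\<in>Basis. D b *\<^sub>R b)"
  have lin: "linear D" using D has_derivative_linear by blast
  have "D h = h \<bullet> g" for h
  proof -
    have "D h = D (\<Sum>b\<in>Basis. (h \<bullet> b) *\<^sub>R b)"
      by (simp add: euclidean_representation)
    also have "\<dots> = h \<bullet> g"
      by (simp add: g_def linear_sum[OF lin] linear_cmul[OF lin] inner_sum_right mult.commute)
    finally show ?thesis .
  qed
  then have g: "GDERIV V x :> g"
    using D unfolding gderiv_def by presburger
  have "gradient V x = g"
    unfolding gradient_def
  proof (rule the_equality, rule g)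
    fix g' assume "GDERIV V x :> g'"
    then have "(\<lambda>h. h \<bullet> g') = (\<lambda>h. h \<bullet> g)"
      using g has_derivative_unique unfolding gderiv_def by blast
    then show "g' = g"
      by (metis vector_eq_ldot)
  qed
  with g show ?thesis
    by (simp add: gderiv_def inner_commute)
qed

lemma lyapunov_has_derivative_along_flow:
  assumes "C1_map V" "global_flow F \<Phi>"
  shows "((\<lambda>s. V (\<Phi> s x)) has_real_derivative gradient V (\<Phi> t x) \<bullet> F (\<Phi> t x)) (at t)"
  using diff_chain_at[of "\<lambda>s. \<Phi> s x" "\<lambda>h. h *\<^sub>R F (\<Phi> t x)" t V "\<lambda>h. gradient V (\<Phi> t x) \<bullet> h"]
    global_flow_has_vector_derivative[OF assms(2)] C1_map_has_derivative_gradient[OF assms(1)]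
  by (simp add: has_vector_derivative_def has_field_derivative_def o_def mult.commute[of _ "_ \<bullet> _"])

text \<open>A positive inner product would make \<open>V\<close> increase for small positive times
  from a point that is not an equilibrium. The sign turns the absolute value of the angle condition
  into a decay rate of \<open>V\<close>.\<close>

lemma gradient_inner_nonpos:
  assumes "C1_map V" "global_flow F \<Phi>" "strict_lyapunov F \<Phi> V"
  shows "gradient V x \<bullet> F x \<le> 0"
proof (rule ccontr)
  assume pos: "\<not> gradient V x \<bullet> F x \<le> 0"
  have "((\<lambda>s. V (\<Phi> s x)) has_real_derivative gradient V x \<bullet> F x) (at 0)"
    using lyapunov_has_derivative_along_flow[OF assms(1,2), of x 0]
    by (simp add: global_flow_0[OF assms(2)])
  then obtain d where "d > 0" "\<And>h. 0 < h \<Longrightarrow> h < d \<Longrightarrow> V (\<Phi> 0 x) < V (\<Phi> (0 + h) x)"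
    using DERIV_pos_inc_right pos by (metis not_le)
  then have "V x < V (\<Phi> (d / 2) x)"
    by (metis add_0 global_flow_0[OF assms(2)] half_gt_zero field_sum_of_halves less_add_same_cancel1)
  moreover have "x \<notin> Eq F" using pos by (auto simp: Eq_def)
  ultimately show False
    using assms(3) \<open>d > 0\<close> unfolding strict_lyapunov_def
    by (metis DiffI UNIV_I half_gt_zero less_asym)
qed

lemma lyapunov_flow_antimono:
  assumes "C1_map V" "global_flow F \<Phi>" "strict_lyapunov F \<Phi> V" "s \<le> t"
  shows "V (\<Phi> t x) \<le> V (\<Phi> s x)"
  using gradient_inner_nonpos[OF assms(1-3)] lyapunov_has_derivative_along_flow[OF assms(1,2)]
  by (intro DERIV_nonpos_imp_nonincreasing[OF \<open>s \<le> t\<close>]) blast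

text \<open>Off the level \<open>v\<close>, the derivative of
  \<open>- c / \<theta> * signed_powr \<theta> (V - v)\<close> along the flow dominates the speed.
  Asking this only in the open interval allows end points on the level \<open>v\<close>.\<close>

lemma flow_displacement_le_nonzero:
  assumes "C1_map V" "global_flow F \<Phi>"
    and \<theta>: "0 < \<theta>" "\<theta> \<le> 1"
    and "a \<le> b"
    and ineq: "\<And>s. a < s \<Longrightarrow> s < b \<Longrightarrow> \<bar>V (\<Phi> s x) - v\<bar> powr (1 - \<theta>) * norm (F (\<Phi> s x))
        \<le> c * - (gradient V (\<Phi> s x) \<bullet> F (\<Phi> s x))"
    and nz: "\<And>s. a < s \<Longrightarrow> s < b \<Longrightarrow> V (\<Phi> s x) \<noteq> v"
  shows "norm (\<Phi> b x - \<Phi> a x)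
      \<le> c / \<theta> * (signed_powr \<theta> (V (\<Phi> a x) - v) - signed_powr \<theta> (V (\<Phi> b x) - v))"
proof (cases "a = b")
  case False
  with \<open>a \<le> b\<close> have "a < b" by simp
  define w where "w s = V (\<Phi> s x) - v" for s
  define w' where "w' s = gradient V (\<Phi> s x) \<bullet> F (\<Phi> s x)" for s
  have w': "(w has_real_derivative w' s) (at s)" for s
    unfolding w_def w'_def
    using lyapunov_has_derivative_along_flow[OF assms(1,2)] by (auto intro!: derivative_eq_intros)
  define \<phi> where "\<phi> s = - c / \<theta> * signed_powr \<theta> (w s)" for s
  have "norm (\<Phi> b x - \<Phi> a x) \<le> \<phi> b - \<phi> a"
  proof (rule differentiable_bound_general[OF \<open>a < b\<close>])
    show "continuous_on {a..b} (\<lambda>s. \<Phi> s x)"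
      by (rule continuous_on_global_flow[OF assms(2)])
    have "continuous_on {a..b} w"
      using w' by (meson DERIV_isCont continuous_at_imp_continuous_on)
    then show "continuous_on {a..b} \<phi>"
      unfolding \<phi>_def
      by (intro continuous_intros continuous_on_compose2[OF continuous_on_signed_powr[OF \<theta>]]) auto
    fix s assume s: "a < s" "s < b"
    show "((\<lambda>s. \<Phi> s x) has_vector_derivative F (\<Phi> s x)) (at s)"
      by (rule global_flow_has_vector_derivative[OF assms(2)])
    have ws: "w s \<noteq> 0" using nz[OF s] by (simp add: w_def)
    have "(\<phi> has_real_derivative - c / \<theta> * (\<theta> * \<bar>w s\<bar> powr (\<theta> - 1) * w' s)) (at s)"
      unfolding \<phi>_def
      by (intro DERIV_cmult DERIV_chain2[OF has_real_derivative_signed_powr[OF ws] w'])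
    then show "(\<phi> has_vector_derivative - c * \<bar>w s\<bar> powr (\<theta> - 1) * w' s) (at s)"
      using \<theta> by (simp add: has_real_derivative_iff_has_vector_derivative mult.assoc)
    \<comment> \<open>Multiplying the hypothesis by the inverse power isolates the speed, since
      \<open>w s\<close> is nonzero.\<close>
    have "\<bar>w s\<bar> powr (\<theta> - 1) * (\<bar>w s\<bar> powr (1 - \<theta>) * norm (F (\<Phi> s x)))
        \<le> \<bar>w s\<bar> powr (\<theta> - 1) * (c * - w' s)"
      using ineq[OF s] by (intro mult_left_mono) (auto simp: w_def w'_def)
    also have "\<bar>w s\<bar> powr (\<theta> - 1) * (\<bar>w s\<bar> powr (1 - \<theta>) * norm (F (\<Phi> s x))) = norm (F (\<Phi> s x))"
      using ws by (simp add: mult.assoc[symmetric] powr_add[symmetric])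
    finally show "norm (F (\<Phi> s x)) \<le> - c * \<bar>w s\<bar> powr (\<theta> - 1) * w' s"
      by (simp add: mult_ac)
  qed
  then show ?thesis
    by (simp add: \<phi>_def w_def algebra_simps)
qed simp

text \<open>A non-stationary orbit crosses the critical level at most once, and splitting there
  leaves two pieces on which the desingularised Lyapunov function is differentiable.\<close>

lemma flow_displacement_le:
  assumes "C1_map F" "C1_map V" "global_flow F \<Phi>" "strict_lyapunov F \<Phi> V"
    and \<theta>: "0 < \<theta>" "\<theta> \<le> 1"
    and "0 \<le> h"
    and ineq: "\<And>s. 0 \<le> s \<Longrightarrow> s \<le> h \<Longrightarrow> \<bar>V (\<Phi> s x) - v\<bar> powr (1 - \<theta>) * norm (F (\<Phi> s x))
        \<le> c * - (gradient V (\<Phi> s x) \<bullet> F (\<Phi> s x))"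
  shows "norm (\<Phi> h x - x)
      \<le> c / \<theta> * (signed_powr \<theta> (V x - v) - signed_powr \<theta> (V (\<Phi> h x) - v))"
proof (cases "\<exists>s. F (\<Phi> s x) = 0")
  case True
  then have "\<Phi> h x = \<Phi> 0 x"
    using global_flow_stationary[OF assms(1,3)] by metis
  then show ?thesis
    by (simp add: global_flow_0[OF assms(3)])
next
  case False
  \<comment> \<open>The orbit meets no equilibrium at any real time, so the strict inequality
    applies from every one of its points.\<close>
  have less: "V (\<Phi> t x) < V (\<Phi> s x)" if "s < t" for s t
    using assms(4) False that global_flow_add[OF assms(1,3), of s "t - s" x]
    unfolding strict_lyapunov_def Eq_def by force
  have piece: "norm (\<Phi> b x - \<Phi> a x)
      \<le> c / \<theta> * (signed_powr \<theta> (V (\<Phi> a x) - v) - signed_powr \<theta> (V (\<Phi> b x) - v))"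
    if "0 \<le> a" "a \<le> b" "b \<le> h" "\<And>s. a < s \<Longrightarrow> s < b \<Longrightarrow> V (\<Phi> s x) \<noteq> v" for a b
    using that ineq by (intro flow_displacement_le_nonzero[OF assms(2,3) \<theta>]) auto
  have "norm (\<Phi> h x - \<Phi> 0 x)
      \<le> c / \<theta> * (signed_powr \<theta> (V (\<Phi> 0 x) - v) - signed_powr \<theta> (V (\<Phi> h x) - v))"
  proof (cases "\<exists>s\<in>{0..h}. V (\<Phi> s x) = v")
    case True
    then obtain s where s: "0 \<le> s" "s \<le> h" "V (\<Phi> s x) = v" by auto
    have ne: "V (\<Phi> t x) \<noteq> v" if "t \<noteq> s" for t
      using less[of s t] less[of t s] that s(3) by linarith
    have "norm (\<Phi> h x - \<Phi> 0 x) \<le> norm (\<Phi> s x - \<Phi> 0 x) + norm (\<Phi> h x - \<Phi> s x)"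
      using norm_triangle_ineq[of "\<Phi> s x - \<Phi> 0 x" "\<Phi> h x - \<Phi> s x"] by simp
    also have "\<dots> \<le> c / \<theta> * (signed_powr \<theta> (V (\<Phi> 0 x) - v) - signed_powr \<theta> (V (\<Phi> s x) - v))
        + c / \<theta> * (signed_powr \<theta> (V (\<Phi> s x) - v) - signed_powr \<theta> (V (\<Phi> h x) - v))"
      using s ne by (intro add_mono piece) auto
    finally show ?thesis by (simp add: algebra_simps)
  next
    case False
    then show ?thesis using \<open>0 \<le> h\<close> by (intro piece) auto
  qed
  then show ?thesis
    by (simp add: global_flow_0[OF assms(3)])
qed

section \<open>Limit sets\<close>

lemma mem_limit_set_iff: "p \<in> limit_set Y \<longleftrightarrow> (\<forall>t\<ge>0. p \<in> closure (Y ` {t..}))"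
proof -
  have "{Y (t + s) |s. 0 \<le> s} = Y ` {t..}" for t
    by (auto simp: image_iff) (metis add.commute diff_add_cancel diff_ge_0_iff_ge)
  then show ?thesis by (auto simp: limit_set_def)
qed

lemma closed_limit_set: "closed (limit_set Y)"
  unfolding limit_set_def by (intro closed_INT) auto

lemma limit_set_subset_closure: "limit_set Y \<subseteq> closure (Y ` {0..})"
  by (auto simp: mem_limit_set_iff)

text \<open>If \<open>K\<close> were visited at arbitrarily late times, the closures of the tails
  would have the finite intersection property in \<open>K\<close>, and a common point would lie in
  the limit set.\<close>

lemma eventually_avoids_compact:
  assumes "compact K" "K \<inter> limit_set Y = {}"
  obtains t0 where "0 \<le> t0" "\<And>t. t0 \<le> t \<Longrightarrow> Y t \<notin> K"
proof -
  have "\<exists>t0\<ge>0. \<forall>t\<ge>t0. Y t \<notin> K"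
  proof (rule ccontr)
    assume "\<not> ?thesis"
    then have hit: "\<exists>t\<ge>t0. Y t \<in> K" if "0 \<le> t0" for t0
      using that by blast
    have "K \<inter> \<Inter>((\<lambda>t. closure (Y ` {t..})) ` {0..}) \<noteq> {}"
    proof (rule compact_imp_fip[OF \<open>compact K\<close>])
      fix \<F> assume "finite \<F>" "\<F> \<subseteq> (\<lambda>t. closure (Y ` {t..})) ` {0..}"
      then obtain S where S: "finite S" "S \<subseteq> {0..}" "\<F> = (\<lambda>t. closure (Y ` {t..})) ` S"
        by (meson finite_subset_image)
      \<comment> \<open>Inserting 0 keeps \<open>m\<close> nonnegative and covers an empty
        \<open>S\<close>.\<close>
      define m where "m = Max (insert 0 S)"
      have m: "0 \<le> m" "\<And>s. s \<in> S \<Longrightarrow> s \<le> m"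
        using S(1) by (auto simp: m_def)
      obtain t where "m \<le> t" "Y t \<in> K" using hit[OF m(1)] by blast
      then have "Y t \<in> closure (Y ` {s..})" if "s \<in> S" for s
        using m(2)[OF that] closure_subset by fastforce
      then show "K \<inter> \<Inter>\<F> \<noteq> {}" using \<open>Y t \<in> K\<close> S(3) by blast
    qed auto
    then show False
      using assms(2) by (auto simp: mem_limit_set_iff)
  qed
  then show thesis using that by blast
qed

text \<open>The part of the closure of the path outside \<open>G\<close> is compact and misses the
  limit set, so it is eventually avoided.\<close>

lemma eventually_in_open_of_limit_set:
  assumes "bounded (Y ` {0..})" "open G" "limit_set Y \<subseteq> G"
  obtains t0 where "0 \<le> t0" "\<And>t. t0 \<le> t \<Longrightarrow> Y t \<in> G"
proof -
  have "compact (closure (Y ` {0..}) - G)"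
    using assms by (intro compact_diff) auto
  moreover have "(closure (Y ` {0..}) - G) \<inter> limit_set Y = {}"
    using assms(3) by auto
  ultimately obtain t0 where t0: "0 \<le> t0" "\<And>t. t0 \<le> t \<Longrightarrow> Y t \<notin> closure (Y ` {0..}) - G"
    using eventually_avoids_compact by metis
  have "Y t \<in> G" if "t0 \<le> t" for t
  proof -
    have "Y t \<in> closure (Y ` {0..})"
      using t0(1) that by (intro closure_subset[THEN subsetD] imageI) auto
    then show ?thesis using t0(2)[OF that] by blast
  qed
  with t0(1) show thesis using that by blast
qed

lemma limit_set_nonempty:
  assumes "bounded (Y ` {0..})"
  shows "limit_set Y \<noteq> {}"
proof
  assume "limit_set Y = {}"
  then obtain t0 where "\<And>t. t0 \<le> t \<Longrightarrow> Y t \<in> {}"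
    using eventually_in_open_of_limit_set[OF assms, of "{}"] by auto
  then show False by blast
qed

lemma compact_limit_set:
  assumes "bounded (Y ` {0..})"
  shows "compact (limit_set Y)"
  using assms closed_limit_set limit_set_subset_closure
  by (metis bounded_closure bounded_subset compact_eq_bounded_closed)

lemma tendsto_imp_mem_limit_set:
  assumes "(Y \<longlongrightarrow> p) at_top"
  shows "p \<in> limit_set Y"
  unfolding mem_limit_set_iff
proof (intro allI impI)
  fix t :: real
  have "\<forall>\<^sub>F s in at_top. Y s \<in> closure (Y ` {t..})"
    by (rule eventually_mono[OF eventually_ge_at_top[of t]])
      (auto intro!: closure_subset[THEN subsetD])
  then show "p \<in> closure (Y ` {t..})"
    using Lim_in_closed_set[OF closed_closure _ _ assms] by simp
qed

text \<open>A late tail lies in the closed set where \<open>V\<close> is within \<epsilon> of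
  \<open>v\<close>, hence so does its closure. Taking half the supposed gap for \<epsilon> gives the
  contradiction.\<close>

lemma continuous_limit_on_limit_set:
  fixes V :: "'a::euclidean_space \<Rightarrow> real"
  assumes "continuous_on UNIV V" "((\<lambda>t. V (Y t)) \<longlongrightarrow> v) at_top" "p \<in> limit_set Y"
  shows "V p = v"
proof (rule ccontr)
  assume "V p \<noteq> v"
  define \<epsilon> where "\<epsilon> = \<bar>V p - v\<bar> / 2"
  have "\<epsilon> > 0" using \<open>V p \<noteq> v\<close> by (simp add: \<epsilon>_def)
  then obtain t0 where t0: "\<And>t. t0 \<le> t \<Longrightarrow> \<bar>V (Y t) - v\<bar> \<le> \<epsilon>"
    using tendstoD[OF assms(2)] unfolding eventually_at_top_linorder dist_real_def
    by (meson less_imp_le)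
  have "closed {x. \<bar>V x - v\<bar> \<le> \<epsilon>}"
    using assms(1) by (intro closed_Collect_le continuous_intros)
  moreover have "Y ` {max 0 t0..} \<subseteq> {x. \<bar>V x - v\<bar> \<le> \<epsilon>}"
    using t0 by auto
  ultimately have "closure (Y ` {max 0 t0..}) \<subseteq> {x. \<bar>V x - v\<bar> \<le> \<epsilon>}"
    by (simp add: closure_minimal)
  then have "\<bar>V p - v\<bar> \<le> \<epsilon>"
    using assms(3) unfolding mem_limit_set_iff by (metis max.cobounded1 mem_Collect_eq subsetD)
  then show False using \<open>\<epsilon> > 0\<close> by (simp add: \<epsilon>_def)
qed

section \<open>Convergence of pseudotrajectories\<close>

text \<open>Multiplying the Lojasiewicz inequality by the speed and applying the angle condition
  gives the constant \<open>c0 / c1\<close>. The bound by 1 on \<open>V x - V p\<close> is arranged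
  so that different exponents can be compared later.\<close>

lemma lojasiewicz_angle_local:
  fixes V :: "'a::euclidean_space \<Rightarrow> real"
  assumes "continuous_on UNIV V" "lojasiewicz_at V p" "angle_condition_at F V p"
    and nonpos: "\<And>x. gradient V x \<bullet> F x \<le> 0"
  shows "\<exists>U \<theta> c. open U \<and> p \<in> U \<and> (\<forall>x\<in>U. \<bar>V x - V p\<bar> < 1) \<and> 0 < \<theta> \<and> \<theta> \<le> 1 / 2 \<and> 0 \<le> c \<and>
    (\<forall>x\<in>U. \<bar>V x - V p\<bar> powr (1 - \<theta>) * norm (F x) \<le> c * - (gradient V x \<bullet> F x))"
proof -
  obtain U1 \<theta> c0 where 1: "open U1" "p \<in> U1" "0 < \<theta>" "\<theta> \<le> 1 / 2" "0 \<le> c0"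
    "\<And>x. x \<in> U1 \<Longrightarrow> \<bar>V x - V p\<bar> powr (1 - \<theta>) \<le> c0 * norm (gradient V x)"
    using assms(2) unfolding lojasiewicz_at_def by blast
  obtain U2 c1 where 2: "open U2" "p \<in> U2" "0 < c1"
    "\<And>x. x \<in> U2 \<Longrightarrow> c1 * norm (gradient V x) * norm (F x) \<le> \<bar>gradient V x \<bullet> F x\<bar>"
    using assms(3) unfolding angle_condition_at_def by blast
  define U where "U = U1 \<inter> U2 \<inter> {x. \<bar>V x - V p\<bar> < 1}"
  have "open U"
    unfolding U_def using 1(1) 2(1) assms(1)
    by (intro open_Int open_Collect_less continuous_intros)
  moreover have "\<bar>V x - V p\<bar> powr (1 - \<theta>) * norm (F x) \<le> c0 / c1 * - (gradient V x \<bullet> F x)"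
    if "x \<in> U" for x
  proof -
    have "\<bar>V x - V p\<bar> powr (1 - \<theta>) * norm (F x) \<le> c0 * norm (gradient V x) * norm (F x)"
      using that 1(6) by (intro mult_right_mono) (auto simp: U_def)
    also have "\<dots> = c0 / c1 * (c1 * norm (gradient V x) * norm (F x))"
      using \<open>0 < c1\<close> by simp
    also have "\<dots> \<le> c0 / c1 * - (gradient V x \<bullet> F x)"
      using that 2(3) 2(4)[of x] 1(5) nonpos[of x] by (intro mult_left_mono) (auto simp: U_def)
    finally show ?thesis .
  qed
  ultimately show ?thesis
    using 1 2 by (intro exI[of _ U] exI[of _ \<theta>] exI[of _ "c0 / c1"]) (auto simp: U_def)
qed

text \<open>A finite subcover allows the least exponent and the largest constant. As
  \<open>\<bar>V x - v\<bar>\<close> is below 1, lowering \<theta> raises the exponent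
  \<open>1 - \<theta>\<close> and so only shrinks the left-hand side.\<close>

lemma lojasiewicz_angle_uniform:
  fixes V :: "'a::euclidean_space \<Rightarrow> real"
  assumes "continuous_on UNIV V" "compact L"
    and loc: "\<And>p. p \<in> L \<Longrightarrow> lojasiewicz_at V p \<and> angle_condition_at F V p \<and> V p = v"
    and nonpos: "\<And>x. gradient V x \<bullet> F x \<le> 0"
  obtains G \<theta> c where "open G" "L \<subseteq> G" "0 < \<theta>" "\<theta> \<le> 1 / 2" "0 \<le> c"
    "\<And>x. x \<in> G \<Longrightarrow> \<bar>V x - v\<bar> powr (1 - \<theta>) * norm (F x) \<le> c * - (gradient V x \<bullet> F x)"
proof -
  have "\<forall>p\<in>L. \<exists>U \<theta> c. open U \<and> p \<in> U \<and> (\<forall>x\<in>U. \<bar>V x - v\<bar> < 1) \<and> 0 < \<theta> \<and> \<theta> \<le> 1 / 2 \<and> 0 \<le> c \<and>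
    (\<forall>x\<in>U. \<bar>V x - v\<bar> powr (1 - \<theta>) * norm (F x) \<le> c * - (gradient V x \<bullet> F x))"
    using lojasiewicz_angle_local[OF assms(1) _ _ nonpos] loc by metis
  then obtain U \<theta> c where *: "\<And>p. p \<in> L \<Longrightarrow> open (U p) \<and> p \<in> U p \<and> (\<forall>x\<in>U p. \<bar>V x - v\<bar> < 1) \<and>
      0 < \<theta> p \<and> \<theta> p \<le> 1 / 2 \<and> 0 \<le> c p \<and>
      (\<forall>x\<in>U p. \<bar>V x - v\<bar> powr (1 - \<theta> p) * norm (F x) \<le> c p * - (gradient V x \<bullet> F x))"
    unfolding bchoice_iff by blast
  obtain D where D: "D \<subseteq> L" "finite D" "L \<subseteq> (\<Union>p\<in>D. U p)"
    using compactE_image[OF \<open>compact L\<close>, of L U] * by blast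
  \<comment> \<open>The inserted elements here and in \<open>c'\<close> keep the extrema meaningful
    when \<open>D\<close> is empty.\<close>
  define \<theta>' where "\<theta>' = Min (insert (1 / 2) (\<theta> ` D))"
  define c' where "c' = Max (insert 0 (c ` D))"
  have "0 < \<theta>'" using D * by (auto simp: \<theta>'_def)
  moreover have \<theta>': "\<theta>' \<le> 1 / 2" "\<And>p. p \<in> D \<Longrightarrow> \<theta>' \<le> \<theta> p"
  proof -
    show "\<theta>' \<le> 1 / 2" unfolding \<theta>'_def using D(2) by (intro Min_le) auto
  qed (use D(2) in \<open>auto simp: \<theta>'_def\<close>)
  moreover have c': "0 \<le> c'" "\<And>p. p \<in> D \<Longrightarrow> c p \<le> c'"
    using D by (auto simp: c'_def)
  moreover have "\<bar>V x - v\<bar> powr (1 - \<theta>') * norm (F x) \<le> c' * - (gradient V x \<bullet> F x)"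
    if x: "x \<in> (\<Union>p\<in>D. U p)" for x
  proof -
    obtain p where p: "p \<in> D" "x \<in> U p" using x by blast
    have p': "\<bar>V x - v\<bar> < 1"
      "\<bar>V x - v\<bar> powr (1 - \<theta> p) * norm (F x) \<le> c p * - (gradient V x \<bullet> F x)"
      using p * D(1) by blast+
    have "\<bar>V x - v\<bar> powr (1 - \<theta>') * norm (F x) \<le> \<bar>V x - v\<bar> powr (1 - \<theta> p) * norm (F x)"
    proof (cases "V x = v")
      case False
      then show ?thesis
        using p' \<theta>'(2)[OF p(1)] by (intro mult_right_mono powr_mono') auto
    qed simp
    also have "\<dots> \<le> c p * - (gradient V x \<bullet> F x)" by (rule p')
    also have "\<dots> \<le> c' * - (gradient V x \<bullet> F x)"
      using c'(2)[OF p(1)] nonpos[of x] by (intro mult_right_mono) auto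
    finally show ?thesis .
  qed
  moreover have "open (\<Union>p\<in>D. U p)" using D(1) * by blast
  ultimately show thesis using that D(3) by blast
qed

text \<open>Since \<open>e < e / 2\<close> for negative \<open>e\<close>, the limsup lies strictly
  below \<open>e / 2\<close>, and the logarithmic quotient eventually does too.\<close>

lemma error_rate_imp_exp_bound:
  assumes "global_flow F \<Phi>" "continuous_on {0..} Y" "0 < T" "e < 0"
    and "error_rate T \<Phi> Y \<le> ereal e"
  obtains t0 where "0 \<le> t0"
    "\<And>t h. t0 \<le> t \<Longrightarrow> 0 \<le> h \<Longrightarrow> h \<le> T \<Longrightarrow> norm (Y (t + h) - \<Phi> h (Y t)) \<le> exp (e * t / 2)"
proof -
  define S where "S t = (SUP h\<in>{0..T}. norm (Y (t + h) - \<Phi> h (Y t)))" for t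
  have "error_rate T \<Phi> Y < ereal (e / 2)"
    using \<open>e < 0\<close> by (intro le_less_trans[OF assms(5)]) simp
  then have "\<forall>\<^sub>F t in at_top. ereal (1 / t) * ext_log (S t) < ereal (e / 2)"
    unfolding error_rate_def S_def by (rule Limsup_lessD)
  then obtain t1 where t1: "\<And>t. t1 \<le> t \<Longrightarrow> ereal (1 / t) * ext_log (S t) < ereal (e / 2)"
    unfolding eventually_at_top_linorder by blast
  have "norm (Y (t + h) - \<Phi> h (Y t)) \<le> exp (e * t / 2)"
    \<comment> \<open>The 1 makes \<open>t\<close> positive, so that the inequality can be
      multiplied by \<open>t\<close>.\<close>
    if t: "max 1 t1 \<le> t" and h: "0 \<le> h" "h \<le> T" for t h
  proof -
    \<comment> \<open>Continuity on the compact window makes the errors bounded, without which the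
      real supremum would not dominate them.\<close>
    have "continuous_on {0..T} (\<lambda>h. norm (Y (t + h) - \<Phi> h (Y t)))"
      using t by (intro continuous_intros continuous_on_global_flow[OF assms(1)]
          continuous_on_compose2[OF assms(2)]) auto
    then have "compact ((\<lambda>h. norm (Y (t + h) - \<Phi> h (Y t))) ` {0..T})"
      by (intro compact_continuous_image) auto
    then have "bdd_above ((\<lambda>h. norm (Y (t + h) - \<Phi> h (Y t))) ` {0..T})"
      by (intro bounded_imp_bdd_above compact_imp_bounded)
    then have le: "norm (Y (t + h) - \<Phi> h (Y t)) \<le> S t" if "h \<in> {0..T}" for h
      unfolding S_def using that by (intro cSUP_upper)
    have "0 \<le> S t" using le[of h] h by (meson atLeastAtMost_iff norm_ge_zero order_trans)
    have "S t \<le> exp (e * t / 2)"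
    proof (cases "S t = 0")
      case False
      have "ereal (ln (S t) / t) < ereal (e / 2)"
        using t1[of t] t False by (simp add: ext_log_def)
      then have "ln (S t) < e * t / 2"
        using t by (simp add: field_simps)
      then show ?thesis
        using False \<open>0 \<le> S t\<close> by (metis exp_le_cancel_iff exp_ln less_eq_real_def)
    qed simp
    then show ?thesis using le[of h] h by simp
  qed
  then show thesis using that[of "max 1 t1"] by auto
qed

text \<open>The deterministic core, to be applied to one path at a time. The local conditions are
  placed on the limit set because the path eventually stays in any neighborhood of it.\<close>

lemma converges_of_error_rate:
  fixes F :: "'a::euclidean_space \<Rightarrow> 'a"
  assumes F: "C1_map F" and flow: "global_flow F \<Phi>" and V: "C1_map V"
    and lyap: "strict_lyapunov F \<Phi> V"
    and contY: "continuous_on {0..} Y" and bddY: "bounded (Y ` {0..})"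
    and "e < 0" "0 < T" "error_rate T \<Phi> Y \<le> ereal e"
    and loc: "\<forall>p\<in>limit_set Y. lojasiewicz_at V p \<and> angle_condition_at F V p"
  obtains p where "p \<in> limit_set Y" "(Y \<longlongrightarrow> p) at_top"
proof -
  have nonpos: "gradient V x \<bullet> F x \<le> 0" for x
    by (rule gradient_inner_nonpos[OF V flow lyap])
  have contV: "continuous_on UNIV V"
    using lyap by (simp add: strict_lyapunov_def)
  obtain t0 where t0: "0 \<le> t0" "\<And>t h. t0 \<le> t \<Longrightarrow> 0 \<le> h \<Longrightarrow> h \<le> T \<Longrightarrow>
      norm (Y (t + h) - \<Phi> h (Y t)) \<le> exp (e * t / 2)"
    using error_rate_imp_exp_bound[OF flow contY \<open>0 < T\<close> \<open>e < 0\<close>] assms(9) by metis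

  \<comment> \<open>Sampling the path at the starts of the windows\<close>
  define r where "r = exp (e * T / 2)"
  have r: "0 < r" "r < 1" using \<open>e < 0\<close> \<open>0 < T\<close> by (auto simp: r_def mult_neg_pos)
  define \<tau> where "\<tau> n = t0 + real n * T" for n
  define x where "x n = Y (\<tau> n)" for n
  have \<tau>0: "t0 \<le> \<tau> n" "0 \<le> \<tau> n" for n
    using t0(1) \<open>0 < T\<close> by (auto simp: \<tau>_def)
  have \<tau>_Suc: "\<tau> (Suc n) = \<tau> n + T" for n
    by (simp add: \<tau>_def algebra_simps)
  have err: "norm (Y (\<tau> n + h) - \<Phi> h (x n)) \<le> r ^ n" if "h \<in> {0..T}" for n h
  proof -
    have "norm (Y (\<tau> n + h) - \<Phi> h (x n)) \<le> exp (e * \<tau> n / 2)"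
      using t0(2) \<tau>0(1) that by (auto simp: x_def)
    \<comment> \<open>The dropped factor \<open>exp (e * t0 / 2)\<close> is at most 1.\<close>
    also have "\<dots> \<le> exp (real n * (e * T / 2))"
      using mult_nonpos_nonneg[of e t0] t0(1) \<open>e < 0\<close> by (simp add: \<tau>_def algebra_simps)
    also have "\<dots> = r ^ n"
      unfolding r_def by (rule exp_of_nat_mult)
    finally show ?thesis .
  qed
  \<comment> \<open>Passes from windows to continuous time: every late \<open>t\<close> is
    \<open>\<tau> n + h\<close> with \<open>n\<close> the integer part of
    \<open>(t - t0) / T\<close>.\<close>
  have ev_block: "eventually P at_top"
    if P: "\<And>n h. n0 \<le> n \<Longrightarrow> h \<in> {0..T} \<Longrightarrow> P (\<tau> n + h)" for n0 P
  proof -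
    have "P t" if t: "\<tau> n0 \<le> t" for t
    proof -
      define n where "n = nat \<lfloor>(t - t0) / T\<rfloor>"
      have ge: "real n0 \<le> (t - t0) / T"
        using t \<open>0 < T\<close> by (simp add: \<tau>_def field_simps)
      then have fl: "real n = of_int \<lfloor>(t - t0) / T\<rfloor>"
        by (simp add: n_def)
      have "n0 \<le> n"
        using ge by (simp add: n_def le_nat_iff le_floor_iff)
      moreover have "real n \<le> (t - t0) / T" "(t - t0) / T \<le> real n + 1"
        unfolding fl by linarith+
      then have "t - \<tau> n \<in> {0..T}"
        using \<open>0 < T\<close> by (simp add: \<tau>_def field_simps)
      ultimately show "P t" using P[of n "t - \<tau> n"] by simp
    qed
    then show ?thesis unfolding eventually_at_top_linorder by blast
  qed

  \<comment> \<open>Comparing the Lyapounov function on the path and on the flow arcs\<close>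
  obtain B where B: "\<And>t. 0 \<le> t \<Longrightarrow> norm (Y t) \<le> B"
    using bddY unfolding bounded_iff by auto
  then have "0 \<le> B" by (meson norm_ge_zero order_refl order_trans)
  \<comment> \<open>The arcs stay within \<open>r ^ n \<le> 1\<close> of the path, so a Lipschitz
    constant \<open>K\<close> of \<open>V\<close> on the ball of radius \<open>B + 1\<close> serves
    both.\<close>
  have B\<Phi>: "norm (\<Phi> h (x n)) \<le> B + 1" if "h \<in> {0..T}" for n h
  proof -
    have "norm (\<Phi> h (x n)) \<le> norm (Y (\<tau> n + h)) + norm (Y (\<tau> n + h) - \<Phi> h (x n))"
      by (metis norm_triangle_sub norm_minus_commute)
    also have "\<dots> \<le> B + 1"
      using B[of "\<tau> n + h"] err[OF that, of n] \<tau>0[of n] that r power_le_one[of r n] by auto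
    finally show ?thesis .
  qed
  obtain K where K: "0 \<le> K" "\<And>y z. norm y \<le> B + 1 \<Longrightarrow> norm z \<le> B + 1 \<Longrightarrow>
      norm (V y - V z) \<le> K * norm (y - z)"
    using C1_map_lipschitz_on_cball[OF V] by metis
  have Verr: "\<bar>V (Y (\<tau> n + h)) - V (\<Phi> h (x n))\<bar> \<le> K * r ^ n" if "h \<in> {0..T}" for n h
  proof -
    have "norm (V (Y (\<tau> n + h)) - V (\<Phi> h (x n))) \<le> K * norm (Y (\<tau> n + h) - \<Phi> h (x n))"
      using B[of "\<tau> n + h"] \<tau>0[of n] that by (intro K(2) B\<Phi>) auto
    also have "\<dots> \<le> K * r ^ n"
      using err[OF that] K(1) by (intro mult_left_mono)
    finally show ?thesis by simp
  qed
  have V\<Phi>_le: "V (\<Phi> h (x n)) \<le> V (x n)" "V (\<Phi> T (x n)) \<le> V (\<Phi> h (x n))"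
    if "h \<in> {0..T}" for n h
    using lyapunov_flow_antimono[OF V flow lyap, of 0 h "x n"]
      lyapunov_flow_antimono[OF V flow lyap, of h T "x n"] that
    by (auto simp: global_flow_0[OF flow])
  have T_in: "T \<in> {0..T}" using \<open>0 < T\<close> by simp
  have Vx_Suc: "\<bar>V (x (Suc n)) - V (\<Phi> T (x n))\<bar> \<le> K * r ^ n" for n
    using Verr[OF T_in, of n] by (simp add: x_def \<tau>_Suc)

  \<comment> \<open>Convergence of the Lyapounov function along the path\<close>
  have r0: "(\<lambda>n. r ^ n) \<longlonglongrightarrow> 0"
    using r by (intro LIMSEQ_realpow_zero) auto
  \<comment> \<open>\<open>V (x n)\<close> can rise by at most \<open>K * r ^ n\<close> in one step.
    The added term is the sum of all such possible rises from step \<open>n\<close> on, which makes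
    \<open>b\<close> nonincreasing.\<close>
  define b where "b n = V (x n) + K / (1 - r) * r ^ n" for n
  have "b (Suc n) \<le> b n" for n
  proof -
    have "b (Suc n) \<le> V (x n) + (K * r ^ n + K / (1 - r) * r ^ Suc n)"
      using Vx_Suc[of n] V\<Phi>_le(1)[OF T_in, of n] by (simp add: b_def)
    also have "K * r ^ n + K / (1 - r) * r ^ Suc n = K / (1 - r) * r ^ n"
      using r by (simp add: field_simps)
    finally show ?thesis by (simp add: b_def)
  qed
  then have "decseq b" by (simp add: decseq_Suc_iff)
  moreover have "V 0 - K * (B + 1) \<le> b n" for n
  proof -
    have xB: "norm (x n) \<le> B" using B[OF \<tau>0(2)] by (simp add: x_def)
    then have "norm (V (x n) - V 0) \<le> K * norm (x n - 0)"
      using \<open>0 \<le> B\<close> by (intro K(2)) auto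
    also have "\<dots> \<le> K * (B + 1)" using K(1) xB by (intro mult_left_mono) auto
    finally have "V 0 - K * (B + 1) \<le> V (x n)" by (simp add: abs_le_iff)
    then show ?thesis
      unfolding b_def using K(1) r by (intro add_increasing2) auto
  qed
  ultimately obtain v where "b \<longlonglongrightarrow> v"
    using decseq_convergent by metis
  then have "(\<lambda>n. b n - K / (1 - r) * r ^ n) \<longlonglongrightarrow> v - K / (1 - r) * 0"
    by (intro tendsto_intros r0)
  then have Vx: "(\<lambda>n. V (x n)) \<longlonglongrightarrow> v"
    by (simp add: b_def)

  have "((\<lambda>t. V (Y t)) \<longlongrightarrow> v) at_top"
  proof (rule tendstoI)
    fix \<epsilon> :: real assume "0 < \<epsilon>"
    have "(\<lambda>n. K * r ^ n) \<longlonglongrightarrow> K * 0" by (intro tendsto_intros r0)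
    then have "\<forall>\<^sub>F n in sequentially. K * r ^ n < \<epsilon> / 4"
      using \<open>0 < \<epsilon>\<close> by (intro order_tendstoD) auto
    moreover have "\<forall>\<^sub>F n in sequentially. \<bar>V (x n) - v\<bar> < \<epsilon> / 2"
      using tendstoD[OF Vx, of "\<epsilon> / 2"] \<open>0 < \<epsilon>\<close> by (simp add: dist_real_def)
    moreover have "\<forall>\<^sub>F n in sequentially. \<bar>V (x (Suc n)) - v\<bar> < \<epsilon> / 2"
      using tendstoD[OF LIMSEQ_Suc[OF Vx], of "\<epsilon> / 2"] \<open>0 < \<epsilon>\<close> by (simp add: dist_real_def)
    \<comment> \<open>On a window, \<open>V\<close> along the arc lies between its end values. The
      lower bound uses the error \<open>K * r ^ n\<close> twice, hence the quarter of
      \<epsilon>.\<close>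
    ultimately have "\<forall>\<^sub>F n in sequentially. \<forall>h\<in>{0..T}. \<bar>V (Y (\<tau> n + h)) - v\<bar> < \<epsilon>"
    proof eventually_elim
      case (elim n)
      show ?case
      proof
        fix h assume "h \<in> {0..T}"
        from Verr[OF this, of n] V\<Phi>_le[OF this, of n] Vx_Suc[of n] elim
        show "\<bar>V (Y (\<tau> n + h)) - v\<bar> < \<epsilon>" by linarith
      qed
    qed
    then show "\<forall>\<^sub>F t in at_top. dist (V (Y t)) v < \<epsilon>"
      unfolding eventually_sequentially dist_real_def using ev_block by meson
  qed
  then have VL: "V p = v" if "p \<in> limit_set Y" for p
    using continuous_limit_on_limit_set contV that by blast

  \<comment> \<open>Confinement of the flow arcs to a neighborhood of the limit set\<close>
  have compL: "compact (limit_set Y)" and neL: "limit_set Y \<noteq> {}"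
    using compact_limit_set limit_set_nonempty bddY by auto
  obtain G \<theta> c where G: "open G" "limit_set Y \<subseteq> G" and \<theta>: "0 < \<theta>" "\<theta> \<le> 1 / 2" and c: "0 \<le> c"
    and ineq: "\<And>x. x \<in> G \<Longrightarrow> \<bar>V x - v\<bar> powr (1 - \<theta>) * norm (F x) \<le> c * - (gradient V x \<bullet> F x)"
    using lojasiewicz_angle_uniform[OF contV compL, of F v] loc VL nonpos by metis
  \<comment> \<open>Half of this margin is spent on the path, the other half on its distance to the
    arcs.\<close>
  obtain \<epsilon> where \<epsilon>: "0 < \<epsilon>" "{y. infdist y (limit_set Y) \<le> \<epsilon>} \<subseteq> G"
    using compact_in_open_separated[OF neL compL G] by metis
  have "open {y. infdist y (limit_set Y) < \<epsilon> / 2}"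
    by (intro open_Collect_less continuous_intros)
  moreover have "limit_set Y \<subseteq> {y. infdist y (limit_set Y) < \<epsilon> / 2}"
    using \<epsilon>(1) by auto
  ultimately obtain t1 where t1: "\<And>t. t1 \<le> t \<Longrightarrow> Y t \<in> {y. infdist y (limit_set Y) < \<epsilon> / 2}"
    using eventually_in_open_of_limit_set[OF bddY] by metis
  have "filterlim \<tau> at_top sequentially"
    unfolding \<tau>_def using \<open>0 < T\<close>
    by (intro filterlim_tendsto_add_at_top[OF tendsto_const]
        filterlim_at_top_mult_tendsto_pos[OF tendsto_const] filterlim_real_sequentially)
  then have "\<forall>\<^sub>F n in sequentially. t1 \<le> \<tau> n"
    unfolding filterlim_at_top by blast
  moreover have "\<forall>\<^sub>F n in sequentially. r ^ n < \<epsilon> / 2"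
    using \<epsilon>(1) by (intro order_tendstoD[OF r0]) auto
  ultimately have "\<forall>\<^sub>F n in sequentially. t1 \<le> \<tau> n \<and> r ^ n < \<epsilon> / 2"
    by (rule eventually_conj)
  then obtain n1 where n1: "\<And>n. n1 \<le> n \<Longrightarrow> t1 \<le> \<tau> n \<and> r ^ n < \<epsilon> / 2"
    unfolding eventually_sequentially by blast
  have in_G: "\<Phi> h (x n) \<in> G" if "n1 \<le> n" "h \<in> {0..T}" for n h
  proof -
    have "infdist (\<Phi> h (x n)) (limit_set Y)
        \<le> infdist (Y (\<tau> n + h)) (limit_set Y) + dist (\<Phi> h (x n)) (Y (\<tau> n + h))"
      by (rule infdist_triangle)
    also have "\<dots> \<le> \<epsilon> / 2 + \<epsilon> / 2"
      using t1[of "\<tau> n + h"] n1[OF that(1)] err[OF that(2), of n] that(2)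
      by (intro add_mono) (auto simp: dist_norm norm_minus_commute)
    finally show ?thesis using \<epsilon>(2) by auto
  qed

  \<comment> \<open>Summable displacements and convergence\<close>
  define \<gamma> where "\<gamma> n = signed_powr \<theta> (V (x n) - v)" for n
  \<comment> \<open>The terms are the distance from path to arc, a telescoping decrease, and the
    Hoelder cost of replacing the end of the arc by \<open>x (Suc n)\<close>.\<close>
  define \<sigma> where "\<sigma> n = r ^ n + c / \<theta> * (\<gamma> n - \<gamma> (Suc n) + 2 * (K * r ^ n) powr \<theta>)" for n
  have displ: "norm (Y (\<tau> n + h) - x n) \<le> \<sigma> n" if n: "n1 \<le> n" and h: "h \<in> {0..T}" for n h
  proof -
    \<comment> \<open>Extending the decrease from time \<open>h\<close> to \<open>T\<close> makes
      the bound independent of \<open>h\<close>.\<close>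
    have "signed_powr \<theta> (V (\<Phi> T (x n)) - v) \<le> signed_powr \<theta> (V (\<Phi> h (x n)) - v)"
      using \<theta> V\<Phi>_le(2)[OF h] by (intro signed_powr_mono) auto
    moreover have "\<gamma> (Suc n) - signed_powr \<theta> (V (\<Phi> T (x n)) - v) \<le> 2 * (K * r ^ n) powr \<theta>"
    proof -
      have "\<gamma> (Suc n) - signed_powr \<theta> (V (\<Phi> T (x n)) - v)
          \<le> 2 * \<bar>V (x (Suc n)) - V (\<Phi> T (x n))\<bar> powr \<theta>"
        using signed_powr_holder[of \<theta> "V (x (Suc n)) - v" "V (\<Phi> T (x n)) - v"] \<theta>
        by (simp add: \<gamma>_def)
      also have "\<dots> \<le> 2 * (K * r ^ n) powr \<theta>"
        using Vx_Suc[of n] \<theta> by (intro mult_left_mono powr_mono2) auto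
      finally show ?thesis .
    qed
    ultimately have "\<gamma> n - signed_powr \<theta> (V (\<Phi> h (x n)) - v)
        \<le> \<gamma> n - \<gamma> (Suc n) + 2 * (K * r ^ n) powr \<theta>"
      by linarith
    then have le: "c / \<theta> * (\<gamma> n - signed_powr \<theta> (V (\<Phi> h (x n)) - v))
        \<le> c / \<theta> * (\<gamma> n - \<gamma> (Suc n) + 2 * (K * r ^ n) powr \<theta>)"
      using c \<theta> by (intro mult_left_mono) auto
    have "norm (\<Phi> h (x n) - x n)
        \<le> c / \<theta> * (\<gamma> n - signed_powr \<theta> (V (\<Phi> h (x n)) - v))"
      unfolding \<gamma>_def using \<theta> h
      by (intro flow_displacement_le[OF F V flow lyap] ineq in_G n) auto
    moreover have "norm (Y (\<tau> n + h) - x n)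
        \<le> norm (Y (\<tau> n + h) - \<Phi> h (x n)) + norm (\<Phi> h (x n) - x n)"
      using norm_triangle_ineq[of "Y (\<tau> n + h) - \<Phi> h (x n)" "\<Phi> h (x n) - x n"] by simp
    ultimately show ?thesis
      using err[OF h, of n] le by (simp add: \<sigma>_def)
  qed
  have "summable \<sigma>"
  proof -
    have "isCont (signed_powr \<theta>) 0"
      using continuous_on_signed_powr[of \<theta> UNIV] \<theta> by (simp add: continuous_on_eq_continuous_at)
    moreover have "(\<lambda>n. V (x n) - v) \<longlonglongrightarrow> 0"
      using Vx by (simp add: LIM_zero)
    ultimately have "\<gamma> \<longlonglongrightarrow> signed_powr \<theta> 0"
      unfolding \<gamma>_def by (rule isCont_tendsto_compose)
    then have "summable (\<lambda>n. \<gamma> n - \<gamma> (Suc n))"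
      by (rule telescope_summable')
    \<comment> \<open>Again a geometric sequence, with ratio
      \<open>r powr \<theta> < 1\<close>.\<close>
    moreover have "(K * r ^ n) powr \<theta> = K powr \<theta> * (r powr \<theta>) ^ n" for n
      using K(1) r by (simp add: powr_mult powr_realpow[symmetric] powr_powr mult.commute)
    then have "summable (\<lambda>n. (K * r ^ n) powr \<theta>)"
      using r \<theta> powr_less_mono2[of \<theta> r 1] by (simp add: summable_mult summable_geometric)
    moreover have "summable (\<lambda>n. r ^ n)"
      using r by (intro summable_geometric) auto
    ultimately show ?thesis
      unfolding \<sigma>_def by (intro summable_add summable_mult)
  qed
  have "summable (\<lambda>n. x (Suc n) - x n)"
  proof (rule summable_comparison_test[OF _ \<open>summable \<sigma>\<close>])
    show "\<exists>N. \<forall>n\<ge>N. norm (x (Suc n) - x n) \<le> \<sigma> n"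
      using displ[OF _ T_in] by (auto simp: x_def \<tau>_Suc)
  qed
  then have "convergent (\<lambda>n. \<Sum>k<n. x (Suc k) - x k)"
    by (simp add: summable_iff_convergent)
  then have "convergent (\<lambda>n. x n - x 0)"
    by (simp add: sum_lessThan_telescope)
  then obtain y where "(\<lambda>n. x n - x 0) \<longlonglongrightarrow> y" by (auto simp: convergent_def)
  then have "(\<lambda>n. x n - x 0 + x 0) \<longlonglongrightarrow> y + x 0" by (intro tendsto_intros)
  then obtain p where p: "x \<longlonglongrightarrow> p" by auto
  have "(Y \<longlongrightarrow> p) at_top"
  proof (rule tendstoI)
    fix \<delta> :: real assume "0 < \<delta>"
    \<comment> \<open>\<open>\<sigma>\<close> bounds the excursion within the whole window, so
      convergence of the samples carries over to the path.\<close>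
    have "\<forall>\<^sub>F n in sequentially. \<sigma> n < \<delta> / 2"
      using \<open>0 < \<delta>\<close> by (intro order_tendstoD[OF summable_LIMSEQ_zero[OF \<open>summable \<sigma>\<close>]]) auto
    moreover have "\<forall>\<^sub>F n in sequentially. dist (x n) p < \<delta> / 2"
      using tendstoD[OF p, of "\<delta> / 2"] \<open>0 < \<delta>\<close> by simp
    ultimately have "\<forall>\<^sub>F n in sequentially. \<forall>h\<in>{0..T}. dist (Y (\<tau> n + h)) p < \<delta>"
      using eventually_ge_at_top[of n1]
    proof eventually_elim
      case (elim n)
      show ?case
      proof
        fix h assume "h \<in> {0..T}"
        from displ[OF elim(3) this] elim dist_triangle[of "Y (\<tau> n + h)" p "x n"]
        show "dist (Y (\<tau> n + h)) p < \<delta>" unfolding dist_norm by linarith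
      qed
    qed
    then show "\<forall>\<^sub>F t in at_top. dist (Y t) p < \<delta>"
      unfolding eventually_sequentially using ev_block by meson
  qed
  then show thesis using that tendsto_imp_mem_limit_set by blast
qed

section \<open>Measurability and the probabilistic conclusion\<close>

text \<open>Expresses the inclusion through countably many balls and rational times, for the sake of
  measurability. Continuity of the path makes rational times suffice.\<close>

lemma limit_set_subset_iff:
  fixes Y :: "real \<Rightarrow> 'a::euclidean_space"
  assumes contY: "continuous_on {0..} Y" and "closed C"
    and dense: "\<And>U. open U \<Longrightarrow> U \<noteq> {} \<Longrightarrow> \<exists>d\<in>D. d \<in> U"
  shows "limit_set Y \<subseteq> C \<longleftrightarrow>
    (\<forall>d\<in>D. \<forall>k::nat. cball d (1 / real (Suc k)) \<inter> C = {} \<longrightarrow>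
      (\<exists>n::nat. \<forall>q\<in>\<rat> \<inter> {real n..}. Y q \<notin> ball d (1 / real (Suc k))))"
    (is "_ \<longleftrightarrow> ?R")
proof
  assume L: "limit_set Y \<subseteq> C"
  show ?R
  proof (intro ballI allI impI)
    fix d and k :: nat
    assume "cball d (1 / real (Suc k)) \<inter> C = {}"
    with L have "cball d (1 / real (Suc k)) \<inter> limit_set Y = {}" by blast
    then obtain t0 where t0: "\<And>t. t0 \<le> t \<Longrightarrow> Y t \<notin> cball d (1 / real (Suc k))"
      using eventually_avoids_compact[OF compact_cball] by metis
    obtain n :: nat where "t0 \<le> real n" using real_arch_simple by blast
    then show "\<exists>n::nat. \<forall>q\<in>\<rat> \<inter> {real n..}. Y q \<notin> ball d (1 / real (Suc k))"
      using t0 ball_subset_cball[of d "1 / real (Suc k)"] by (meson IntD2 atLeast_iff order_trans subsetD)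
  qed
next
  assume R: ?R
  show "limit_set Y \<subseteq> C"
  proof (rule subsetI, rule ccontr)
    fix p assume p: "p \<in> limit_set Y" "p \<notin> C"
    then obtain \<epsilon> where \<epsilon>: "0 < \<epsilon>" "ball p \<epsilon> \<subseteq> - C"
      using \<open>closed C\<close> open_contains_ball[of "- C"] by (auto simp: open_Compl)
    \<comment> \<open>A ball of this radius whose centre is within the same radius of
      \<open>p\<close> stays inside \<open>ball p \<epsilon>\<close>, hence off
      \<open>C\<close>.\<close>
    obtain k :: nat where k: "1 / real (Suc k) < \<epsilon> / 2"
      using nat_approx_posE \<epsilon>(1) by (metis half_gt_zero)
    obtain d where d: "d \<in> D" "d \<in> ball p (1 / real (Suc k))"
      using dense[of "ball p (1 / real (Suc k))"] by auto
    have "cball d (1 / real (Suc k)) \<subseteq> ball p \<epsilon>"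
    proof
      fix z assume "z \<in> cball d (1 / real (Suc k))"
      then show "z \<in> ball p \<epsilon>"
        using d(2) k dist_triangle[of p z d] by (simp del: of_nat_Suc)
    qed
    then obtain n :: nat where n: "\<forall>q\<in>\<rat> \<inter> {real n..}. Y q \<notin> ball d (1 / real (Suc k))"
      using R d(1) \<epsilon>(2) by blast
    have "p \<in> closure (Y ` {real n..})" "p \<in> ball d (1 / real (Suc k))"
      using p(1) d(2) by (auto simp: mem_limit_set_iff dist_commute simp del: of_nat_Suc)
    then obtain t where t: "real n \<le> t" "Y t \<in> ball d (1 / real (Suc k))"
      using open_Int_closure_eq_empty[OF open_ball, of d "1 / real (Suc k)" "Y ` {real n..}"] by blast
    \<comment> \<open>The room left in the open ball around \<open>Y t\<close>: a rational time just
      after \<open>t\<close> still hits the ball.\<close>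
    define \<eta> where "\<eta> = 1 / real (Suc k) - dist d (Y t)"
    have "0 < \<eta>" using t(2) by (simp add: \<eta>_def)
    then obtain \<delta> where \<delta>: "0 < \<delta>" "\<And>s. 0 \<le> s \<Longrightarrow> dist s t < \<delta> \<Longrightarrow> dist (Y s) (Y t) < \<eta>"
      using contY t(1) unfolding continuous_on_iff by (metis atLeast_iff of_nat_0_le_iff order_trans)
    obtain q where q: "q \<in> \<rat>" "t < q" "q < t + \<delta>"
      using Rats_dense_in_real[of t "t + \<delta>"] \<delta>(1) by auto
    then have "dist (Y q) (Y t) < \<eta>"
      using t(1) by (intro \<delta>(2)) (auto simp: dist_real_def)
    then have "Y q \<in> ball d (1 / real (Suc k))"
      using dist_triangle[of d "Y q" "Y t"] by (simp add: \<eta>_def dist_commute)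
    then show False using n q t(1) by auto
  qed
qed

lemma sets_limit_set_subset:
  fixes X :: "real \<Rightarrow> 'w \<Rightarrow> 'a::euclidean_space"
  assumes "continuous_process M X" "closed C"
  shows "{\<omega> \<in> space M. limit_set (\<lambda>t. X t \<omega>) \<subseteq> C} \<in> sets M"
proof -
  obtain D :: "'a set" where D: "countable D" "\<And>U. open U \<Longrightarrow> U \<noteq> {} \<Longrightarrow> \<exists>d\<in>D. d \<in> U"
    using countable_dense_exists by blast
  have X: "X t \<in> borel_measurable M" if "0 \<le> t" for t
    using assms(1) that by (simp add: continuous_process_def)
  have "{\<omega> \<in> space M. limit_set (\<lambda>t. X t \<omega>) \<subseteq> C} =
    {\<omega> \<in> space M. \<forall>d\<in>D. \<forall>k::nat. cball d (1 / real (Suc k)) \<inter> C = {} \<longrightarrow>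
      (\<exists>n::nat. \<forall>q\<in>\<rat> \<inter> {real n..}. X q \<omega> \<notin> ball d (1 / real (Suc k)))}"
    using assms(1) limit_set_subset_iff[OF _ assms(2) D(2)]
    unfolding continuous_process_def by blast
  also have "\<dots> \<in> sets M"
  proof -
    have "{\<omega> \<in> space M. X q \<omega> \<notin> ball d \<rho>} \<in> sets M" if "q \<in> \<rat> \<inter> {real n..}" for q n d \<rho>
    proof -
      \<comment> \<open>Here \<open>q \<ge> real n \<ge> 0\<close>, as required by
        \<open>continuous_process\<close>.\<close>
      have "X q \<in> borel_measurable M"
        using that by (intro X) (auto intro: order_trans[OF of_nat_0_le_iff])
      from measurable_sets[OF this, of "- ball d \<rho>"] show ?thesis
        by (simp add: vimage_def Int_def conj_commute)
    qed
    moreover have "countable (\<rat> \<inter> {real n..})" for n :: nat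
      using countable_rat by blast
    ultimately show ?thesis
      using D(1)
      by (intro sets.sets_Collect_countable_All' sets.sets_Collect_countable_All
          sets.sets_Collect_imp sets.sets_Collect_const sets.sets_Collect_countable_Ex)
  qed
  finally show ?thesis .
qed

text \<open>Measurability of the event belongs to the conclusion because \<open>measure\<close> is
  also 0 on sets outside \<open>sets M\<close>.\<close>

theorem theorem4p2:
  fixes F :: "real ^ 'm \<Rightarrow> real ^ 'm"
    and \<Phi> :: "real \<Rightarrow> real ^ 'm \<Rightarrow> real ^ 'm"
    and V :: "real ^ 'm \<Rightarrow> real"
    and M :: "'w measure"
    and X :: "real \<Rightarrow> 'w \<Rightarrow> real ^ 'm"
    and C :: "(real ^ 'm) set"
    and e T :: real
  assumes "C1_map F"
    and "global_flow F \<Phi>"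
    and "C1_map V"
    and "strict_lyapunov F \<Phi> V"
    and "prob_space M"
    and "continuous_process M X"
    and "AE \<omega> in M. bounded ((\<lambda>t. X t \<omega>) ` {0..})"
    and "e < 0"
    and "T > 0"
    and "AE \<omega> in M. error_rate T \<Phi> (\<lambda>t. X t \<omega>) \<le> ereal e"
    and "C \<subseteq> Eq F"
    and "compact C"
    and "connected C"
    and "\<forall>p\<in>C. lojasiewicz_at V p \<and> angle_condition_at F V p"
    and "{e<..<0} \<inter> sacker_sell_resolvent \<Phi> C \<noteq> {}"
    and "\<forall>p\<in>C. repulsive M X p"
  shows "{\<omega> \<in> space M. limit_set (\<lambda>t. X t \<omega>) \<subseteq> C} \<in> sets M \<and>
         measure M {\<omega> \<in> space M. limit_set (\<lambda>t. X t \<omega>) \<subseteq> C} = 0"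
proof -
  interpret prob_space M by fact
  have meas: "{\<omega> \<in> space M. limit_set (\<lambda>t. X t \<omega>) \<subseteq> C} \<in> sets M"
    using assms(6,12) by (intro sets_limit_set_subset compact_imp_closed)
  obtain U where U: "\<And>p. p \<in> C \<Longrightarrow> open (U p) \<and> p \<in> U p \<and>
      (\<forall>n::nat. prob {\<omega> \<in> space M. exit_time X (U p) (real n) \<omega> < \<infinity>} = 1)"
    using assms(16) unfolding repulsive_def bchoice_iff by blast
  \<comment> \<open>Each point of \<open>C\<close> brings its own null set; finiteness of
    \<open>D\<close> keeps their union null.\<close>
  obtain D where D: "D \<subseteq> C" "finite D" "C \<subseteq> (\<Union>p\<in>D. U p)"
    using compactE_image[OF \<open>compact C\<close>, of C U] U by blast
  have "AE \<omega> in M. \<forall>n::nat. exit_time X (U p) (real n) \<omega> < \<infinity>" if "p \<in> D" for p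
    unfolding AE_all_countable
  proof
    fix n :: nat
    have "AE \<omega> in M. \<omega> \<in> {\<omega> \<in> space M. exit_time X (U p) (real n) \<omega> < \<infinity>}"
      using U D(1) that by (intro AE_prob_1) blast
    then show "AE \<omega> in M. exit_time X (U p) (real n) \<omega> < \<infinity>" by auto
  qed
  then have "AE \<omega> in M. \<forall>p\<in>D. \<forall>n::nat. exit_time X (U p) (real n) \<omega> < \<infinity>"
    using D(2) by (simp add: AE_finite_all)
  with assms(7,10) AE_space[of M]
  have "AE \<omega> in M. \<not> limit_set (\<lambda>t. X t \<omega>) \<subseteq> C"
  proof eventually_elim
    case (elim \<omega>)
    show ?case
    proof
      assume L: "limit_set (\<lambda>t. X t \<omega>) \<subseteq> C"
      then have loc: "\<forall>p\<in>limit_set (\<lambda>t. X t \<omega>). lojasiewicz_at V p \<and> angle_condition_at F V p"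
        using assms(14) by blast
      have "continuous_on {0..} (\<lambda>t. X t \<omega>)"
        using assms(6) elim(3) by (simp add: continuous_process_def)
      from converges_of_error_rate[OF assms(1-4) this elim(1) assms(8,9) elim(2) loc]
      obtain p where p: "p \<in> limit_set (\<lambda>t. X t \<omega>)" "((\<lambda>t. X t \<omega>) \<longlongrightarrow> p) at_top" .
      obtain q where q: "q \<in> D" "p \<in> U q" using p(1) L D(3) by blast
      then have "\<forall>\<^sub>F t in at_top. X t \<omega> \<in> U q"
        using U D(1) by (intro topological_tendstoD[OF p(2)]) auto
      then obtain t0 where t0: "\<And>t. t0 \<le> t \<Longrightarrow> X t \<omega> \<in> U q"
        unfolding eventually_at_top_linorder by blast
      obtain n :: nat where "t0 \<le> real n" using real_arch_simple by blast
      \<comment> \<open>The path no longer leaves \<open>U q\<close> after time \<open>n\<close>,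
        and the infimum of the empty set in \<open>ereal\<close> is \<infinity>, against
        repulsiveness.\<close>
      then have "{ereal t |t. real n \<le> t \<and> X t \<omega> \<in> UNIV - U q} = {}"
        using t0 by fastforce
      then have "exit_time X (U q) (real n) \<omega> = \<infinity>"
        unfolding exit_time_def by (simp only: Inf_empty top_ereal_def)
      then show False using elim(4) q(1) by fastforce
    qed
  qed
  then show ?thesis
    using meas by (subst prob_eq_0) auto
qed

end
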